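(* Assume the principle $\diamondsuit({}^{\omega}\omega,<)$. Then for every almost disjoint family $\mathcal{A}=\{A_\alpha:\alpha<\omega_1\}$ of infinite subsets of $\omega$ there is a sequence $\langle g_n:n<\omega\rangle$ of functions $g_n:\omega_1\to\omega$ such that, for every sequence $\langle P_n:n<\omega\rangle$ of subsets of $\omega$, either the set $$\{\alpha<\omega_1:\ \exists n<\omega\ \text{such that } P_n\cap A_\alpha \text{ is infinite}\}$$ or the set $$\{\alpha<\omega_1:\ \forall n<\omega\ \ P_n\cap A_\alpha\subseteq g_n(\alpha)\}$$ is a stationary subset of $\omega_1$.
   Context: Natural numbers are identified with von Neumann ordinals, so $n=\{0,1,\dots,n-1\}$ for $n<\omega$. ${}^{X}Y$ denotes the set of functions from $X$ to $Y$, and ${}^{<\omega_1}2=\bigcup_{\alpha<\omega_1}{}^{\alpha}2$. Almost disjoint family: a set $\mathcal{A}$ of infinite subsets of $\omega$ such that $X\cap Y$ is finite for all distinct $X,Y\in\mathcal{A}$. For $f,g\in{}^{\omega}\omega$, $f<g$ means $f(n)<g(n)$ for every $n<\omega$. The spaces ${}^{\omega}\omega$ and ${}^{\alpha}2$ ($\alpha<\omega_1$) carry the product topology of discrete spaces. A map between Borel subsets of Polish spaces is Borel if preimages of Borel sets are Borel. A map $F:{}^{<\omega_1}2\to{}^{\omega}\omega$ is called Borel if, for each $\alpha<\omega_1$, its restriction $F\upharpoonright{}^{\alpha}2:{}^{\alpha}2\to{}^{\omega}\omega$ is Borel. The principle $\diamondsuit({}^{\omega}\omega,<)$ is the statement: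 for every Borel $F:{}^{<\omega_1}2\to{}^{\omega}\omega$ there is $g:\omega_1\to{}^{\omega}\omega$ such that for every $f\in{}^{\omega_1}2$ the set $\{\alpha<\omega_1: F(f\upharpoonright\alpha)<g(\alpha)\}$ is stationary in $\omega_1$. *)

theory Defs
  imports "HOL-Analysis.Analysis"
begin

section \<open>The ordinal \<open>\<omega>\<^sub>1\<close>\<close>

text \<open>\<open>natLeq\<close> is a cardinal well-order of type \<open>\<omega>\<close>, and \<open>cardSuc natLeq\<close> is its
  cardinal successor, i.e. a well-order of type \<open>\<omega>\<^sub>1\<close>. An ordinal \<open>\<alpha> < \<omega>\<^sub>1\<close> is an element
  of the type below; as a set of ordinals it is \<open>{..<\<alpha>}\<close>.\<close>

typedef omega1 = "Field (cardSuc natLeq)"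
proof -
  have "infinite (Field (cardSuc natLeq))"
    using cardSuc_finite[OF natLeq_Card_order] by (simp add: Field_natLeq)
  then have "Field (cardSuc natLeq) \<noteq> {}"
    by force
  then show "\<exists>x. x \<in> Field (cardSuc natLeq)"
    by blast
qed

lemma Well_order_cardSuc_natLeq: "Well_order (cardSuc natLeq)"
  using cardSuc_Card_order[OF natLeq_Card_order] card_order_on_well_order_on by blast

instantiation omega1 :: wellorder
begin

definition less_eq_omega1 :: "omega1 \<Rightarrow> omega1 \<Rightarrow> bool" where
  "\<alpha> \<le> \<beta> \<longleftrightarrow> (Rep_omega1 \<alpha>, Rep_omega1 \<beta>) \<in> cardSuc natLeq"

definition less_omega1 :: "omega1 \<Rightarrow> omega1 \<Rightarrow> bool" where
  "(\<alpha> :: omega1) < \<beta> \<longleftrightarrow> \<alpha> \<le> \<beta> \<and> \<alpha> \<noteq> \<beta>"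

instance
proof
  let ?r = "cardSuc natLeq"
  have lin: "Linear_order ?r" and wf: "wf (?r - Id)"
    using Well_order_cardSuc_natLeq by (auto simp: well_order_on_def)
  have refl: "Refl ?r" and trans: "trans ?r" and anti: "antisym ?r" and tot: "Total ?r"
    using lin by (auto simp: order_on_defs)
  fix x y z :: omega1
  show refl': "x \<le> x"
    using refl Rep_omega1[of x] by (auto simp: less_eq_omega1_def refl_on_def)
  show anti': "x = y" if "x \<le> y" "y \<le> x"
    using that anti by (auto simp: less_eq_omega1_def Rep_omega1_inject[symmetric] dest: antisymD)
  show "x \<le> z" if "x \<le> y" "y \<le> z"
    using that trans by (auto simp: less_eq_omega1_def dest: transD)
  show "x \<le> y \<or> y \<le> x"
  proof (cases "x = y")
    case True
    then show ?thesis using refl' by simp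
  next
    case False
    then show ?thesis
      using tot Rep_omega1[of x] Rep_omega1[of y]
      by (auto simp: less_eq_omega1_def total_on_def Rep_omega1_inject)
  qed
  show "x < y \<longleftrightarrow> x \<le> y \<and> \<not> y \<le> x"
    using anti' refl' by (auto simp: less_omega1_def)
  show "P a" if step: "\<And>x. (\<And>y. y < x \<Longrightarrow> P y) \<Longrightarrow> P x" for P and a :: omega1
  proof -
    have "wf (inv_image (?r - Id) Rep_omega1)"
      using wf by (rule wf_inv_image)
    then show ?thesis
    proof (induction a rule: wf_induct_rule)
      case (less x)
      show ?case
        by (rule step, rule less)
          (auto simp: less_omega1_def less_eq_omega1_def Rep_omega1_inject)
    qed
  qed
qed

end

lemma countable_iff_ordLeq_natLeq:
  includes cardinal_syntax
  shows "countable A \<longleftrightarrow> |A| \<le>o natLeq"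
proof -
  have "countable A \<longleftrightarrow> |A| \<le>o |UNIV :: nat set|"
    unfolding countable_def card_of_ordLeq[symmetric] by auto
  then show ?thesis
    using card_of_nat ordLeq_ordIso_trans ordIso_symmetric by blast
qed

text \<open>The next two facts characterise the order type: uncountable, with all proper initial
  segments countable.\<close>

lemma uncountable_omega1:
  includes cardinal_syntax
  shows "uncountable (UNIV :: omega1 set)"
proof
  let ?r = "cardSuc natLeq"
  assume "countable (UNIV :: omega1 set)"
  then have "countable (Field ?r)"
    using type_definition.Rep_range[OF type_definition_omega1] countable_image by metis
  then have "|Field ?r| \<le>o natLeq"
    by (simp add: countable_iff_ordLeq_natLeq)
  then have "?r \<le>o natLeq"
    using card_of_Field_ordIso[OF cardSuc_Card_order[OF natLeq_Card_order]]
      ordIso_ordLeq_trans ordIso_symmetric by blast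
  then show False
    using cardSuc_greater[OF natLeq_Card_order] not_ordLess_ordLeq by blast
qed

lemma countable_lessThan_omega1:
  includes cardinal_syntax
  shows "countable {..<\<alpha> :: omega1}"
proof -
  let ?r = "cardSuc natLeq"
  have "|underS ?r (Rep_omega1 \<alpha>)| <o ?r"
    using card_of_underS[OF cardSuc_Card_order[OF natLeq_Card_order] Rep_omega1] .
  then have "|underS ?r (Rep_omega1 \<alpha>)| \<le>o natLeq"
    using cardSuc_ordLeq_ordLess[OF natLeq_Card_order card_of_Card_order] by blast
  then have "countable (underS ?r (Rep_omega1 \<alpha>))"
    by (simp add: countable_iff_ordLeq_natLeq)
  moreover have "Rep_omega1 ` {..<\<alpha>} \<subseteq> underS ?r (Rep_omega1 \<alpha>)"
    by (auto simp: less_omega1_def less_eq_omega1_def underS_def Rep_omega1_inject)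
  moreover have "inj_on Rep_omega1 {..<\<alpha>}"
    by (auto simp: inj_on_def Rep_omega1_inject)
  ultimately show ?thesis
    by (metis countable_subset countable_image_inj_on)
qed


section \<open>Stationary sets\<close>

definition unbounded_omega1 :: "omega1 set \<Rightarrow> bool" where
  "unbounded_omega1 C \<longleftrightarrow> (\<forall>\<alpha>. \<exists>\<beta>\<in>C. \<alpha> < \<beta>)"

text \<open>The premise \<open>\<exists>\<beta>. \<beta> < \<delta>\<close> says \<open>\<delta> \<noteq> 0\<close>; a nonzero \<open>\<delta>\<close> with \<open>C \<inter> \<delta>\<close> unbounded in \<open>\<delta>\<close> is
  automatically a limit ordinal.\<close>

definition closed_omega1 :: "omega1 set \<Rightarrow> bool" where
  "closed_omega1 C \<longleftrightarrow>
    (\<forall>\<delta>. (\<exists>\<beta>. \<beta> < \<delta>) \<and> (\<forall>\<beta><\<delta>. \<exists>\<gamma>\<in>C. \<beta> < \<gamma> \<and> \<gamma> < \<delta>) \<longrightarrow> \<delta> \<in> C)"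

definition club_omega1 :: "omega1 set \<Rightarrow> bool" where
  "club_omega1 C \<longleftrightarrow> closed_omega1 C \<and> unbounded_omega1 C"

definition stationary_omega1 :: "omega1 set \<Rightarrow> bool" where
  "stationary_omega1 S \<longleftrightarrow> (\<forall>C. club_omega1 C \<longrightarrow> S \<inter> C \<noteq> {})"


section \<open>Borel maps on binary sequences of countable length\<close>

definition borel_of_topology :: "'a topology \<Rightarrow> 'a measure" where
  "borel_of_topology X = sigma (topspace X) {U. openin X U}"

text \<open>The space \<open>\<^sup>\<alpha>2\<close>: its points are the functions in \<open>{..<\<alpha>} \<rightarrow>\<^sub>E UNIV\<close>, with \<open>2\<close> rendered as
  \<^typ>\<open>bool\<close>.\<close>

definition seq2_topology :: "omega1 \<Rightarrow> (omega1 \<Rightarrow> bool) topology" where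
  "seq2_topology \<alpha> = product_topology (\<lambda>_. discrete_topology (UNIV :: bool set)) {..<\<alpha>}"

text \<open>A map on the disjoint union of the spaces \<open>\<^sup>\<alpha>2\<close> is given as a family \<open>F\<close>, where \<open>F \<alpha>\<close> is the
  restriction to \<open>\<^sup>\<alpha>2\<close>. The index is needed because extensional functions on different \<open>{..<\<alpha>}\<close>
  may be equal as HOL functions. The values of \<open>F \<alpha>\<close> outside \<open>\<^sup>\<alpha>2\<close> are irrelevant. The type
  \<^typ>\<open>nat \<Rightarrow> nat\<close> carries the product topology of the discrete topologies, and \<open>borel\<close> is its
  Borel \<open>\<sigma>\<close>-algebra.\<close>

definition borel_map_seq2 :: "(omega1 \<Rightarrow> (omega1 \<Rightarrow> bool) \<Rightarrow> (nat \<Rightarrow> nat)) \<Rightarrow> bool" where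
  "borel_map_seq2 F \<longleftrightarrow> (\<forall>\<alpha>. F \<alpha> \<in> measurable (borel_of_topology (seq2_topology \<alpha>)) borel)"


section \<open>The diamond principle for \<open>(\<^sup>\<omega>\<omega>, <)\<close>\<close>

text \<open>Strict domination at every argument; the library order \<open><\<close> on functions is weaker.\<close>

definition less_everywhere :: "(nat \<Rightarrow> nat) \<Rightarrow> (nat \<Rightarrow> nat) \<Rightarrow> bool" where
  "less_everywhere f g \<longleftrightarrow> (\<forall>n. f n < g n)"

definition diamond_baire_less :: bool where
  "diamond_baire_less \<longleftrightarrow>
    (\<forall>F. borel_map_seq2 F \<longrightarrow>
      (\<exists>g :: omega1 \<Rightarrow> nat \<Rightarrow> nat. \<forall>f :: omega1 \<Rightarrow> bool.
        stationary_omega1 {\<alpha>. less_everywhere (F \<alpha> (restrict f {..<\<alpha>})) (g \<alpha>)}))"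


section \<open>Almost disjoint families\<close>

definition almost_disjoint_family :: "nat set set \<Rightarrow> bool" where
  "almost_disjoint_family \<A> \<longleftrightarrow>
    (\<forall>X\<in>\<A>. infinite X) \<and> (\<forall>X\<in>\<A>. \<forall>Y\<in>\<A>. X \<noteq> Y \<longrightarrow> finite (X \<inter> Y))"

end

theory Submission
  imports Defs
begin

text \<open>A sequence of subsets of \<open>\<omega>\<close> is a single element of \<open>\<^sup>\<omega>\<^sup>\<times>\<^sup>\<omega>2\<close>, so it can be written into
  countably many places of one \<open>f \<in> \<^sup>\<omega>\<^sub>12\<close>. All these places lie below some \<open>\<delta> < \<omega>\<^sub>1\<close>, hence the
  restriction of \<open>f\<close> to any \<open>\<alpha> > \<delta>\<close> still determines the whole sequence \<open>P\<close>. Let \<open>F\<close> read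
  \<open>P\<close> off \<open>f\<restriction>\<alpha>\<close> and return the function sending \<open>n\<close> to the least bound of \<open>P\<^sub>n \<inter> A\<^sub>\<alpha>\<close>, whenever
  this set is finite (\<open>intersection_bound\<close>). It depends on countably many coordinates through
  countable quantifiers only, so it is Borel (\<open>borel_map_seq2_intersection_bound\<close>), and the
  diamond principle yields a guess \<open>g\<close>.

  Suppose that for some \<open>P\<close> both sets are nonstationary, as witnessed by clubs \<open>C\<close> and \<open>D\<close>.
  The intersection of \<open>C\<close>, \<open>D\<close> and the tail above \<open>\<delta>\<close> is a club (\<open>club_omega1_Int\<close>), so it
  meets the stationary set of all \<open>\<alpha>\<close> where \<open>g\<close> dominates \<open>F\<close>. At such an \<open>\<alpha>\<close>,
  every \<open>P\<^sub>n \<inter> A\<^sub>\<alpha>\<close> is finite because \<open>\<alpha> \<in> C\<close>, so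
  \<open>F\<close> really bounds all of them at \<open>\<alpha>\<close>; hence so does \<open>g\<close>, contradicting \<open>\<alpha> \<in> D\<close>.\<close>

lemma countable_omega1_bounded:
  fixes S :: "omega1 set"
  assumes "countable S"
  shows "\<exists>\<delta>. \<forall>x\<in>S. x < \<delta>"
proof (rule ccontr)
  assume "\<not> ?thesis"
  then have "\<exists>x\<in>S. \<delta> \<le> x" for \<delta>
    by (meson not_less)
  then have "UNIV = (\<Union>x\<in>S. insert x {..<x})"
    by (fastforce simp: le_less)
  moreover have "countable (\<Union>x\<in>S. insert x {..<x})"
    using assms countable_lessThan_omega1 by (intro countable_UN) auto
  ultimately show False
    using uncountable_omega1 by simp
qed

lemma club_omega1_greaterThan: "club_omega1 {\<delta><..}"
proof -
  have "closed_omega1 {\<delta><..}"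
    unfolding closed_omega1_def by (force intro: less_trans)
  moreover have "\<exists>\<beta>>\<delta>. \<alpha> < \<beta>" for \<alpha>
    using countable_omega1_bounded[of "{\<alpha>, \<delta>}"] by auto
  ultimately show ?thesis
    by (auto simp: club_omega1_def unbounded_omega1_def)
qed

text \<open>Climbing alternately through the two clubs, the supremum of the resulting \<open>\<omega>\<close>-sequence is a
  limit of both, hence a member of both.\<close>

lemma club_omega1_Int:
  assumes "club_omega1 C" and "club_omega1 D"
  shows "club_omega1 (C \<inter> D)"
proof -
  obtain c where c: "\<And>\<beta>. c \<beta> \<in> C" "\<And>\<beta>. \<beta> < c \<beta>"
    using assms(1) unfolding club_omega1_def unbounded_omega1_def by metis
  obtain d where d: "\<And>\<beta>. d \<beta> \<in> D" "\<And>\<beta>. \<beta> < d \<beta>"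
    using assms(2) unfolding club_omega1_def unbounded_omega1_def by metis
  have closed: "closed_omega1 C" "closed_omega1 D"
    using assms by (auto simp: club_omega1_def)
  have "\<exists>\<delta>\<in>C \<inter> D. \<alpha> < \<delta>" for \<alpha>
  proof -
    define s where "s n = ((d \<circ> c) ^^ n) \<alpha>" for n
    have s_Suc: "s (Suc n) = d (c (s n))" for n
      by (simp add: s_def)
    have s_less: "s n < s (Suc n)" for n
      using c(2) d(2) less_trans by (metis s_Suc)
    define \<delta> where "\<delta> = (LEAST \<gamma>. \<forall>n. s n \<le> \<gamma>)"
    have "\<exists>\<gamma>. \<forall>n. s n \<le> \<gamma>"
      using countable_omega1_bounded[of "range s"] less_imp_le by blast
    then have s_le: "\<forall>n. s n \<le> \<delta>"
      unfolding \<delta>_def by (rule LeastI_ex)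
    have s_less_\<delta>: "s n < \<delta>" for n
      using s_less s_le less_le_trans by blast
    have below: "\<exists>n. \<beta> < s n" if "\<beta> < \<delta>" for \<beta>
      using that not_less_Least[of \<beta> "\<lambda>\<gamma>. \<forall>n. s n \<le> \<gamma>"] by (auto simp: \<delta>_def not_le)
    have c_less_\<delta>: "c (s n) < \<delta>" for n
      using d(2)[of "c (s n)"] s_less_\<delta>[of "Suc n"] by (simp add: s_Suc)
    have "\<exists>\<gamma>\<in>C. \<beta> < \<gamma> \<and> \<gamma> < \<delta>" if "\<beta> < \<delta>" for \<beta>
      using below[OF that] c c_less_\<delta> less_trans by metis
    moreover have "\<exists>\<gamma>\<in>D. \<beta> < \<gamma> \<and> \<gamma> < \<delta>" if "\<beta> < \<delta>" for \<beta>
      using below[OF that] d(1) s_less_\<delta> s_less s_Suc less_trans by metis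
    moreover have "\<alpha> < \<delta>"
      using s_less_\<delta>[of 0] by (simp add: s_def)
    ultimately show ?thesis
      using closed unfolding closed_omega1_def by blast
  qed
  moreover have "closed_omega1 (C \<inter> D)"
    using closed unfolding closed_omega1_def by blast
  ultimately show ?thesis
    by (simp add: club_omega1_def unbounded_omega1_def)
qed

lemma space_borel_of_topology: "space (borel_of_topology X) = topspace X"
  unfolding borel_of_topology_def
  by (rule space_measure_of) (auto dest: openin_subset)

lemma openin_in_sets_borel_of_topology:
  assumes "openin X U"
  shows "U \<in> sets (borel_of_topology X)"
proof -
  have "{U. openin X U} \<subseteq> Pow (topspace X)"
    by (auto dest: openin_subset)
  then show ?thesis
    using assms by (simp add: borel_of_topology_def sets_measure_of)
qed

text \<open>Places at or above \<open>\<alpha>\<close> are harmless: extensional functions take a fixed value there.\<close>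

lemma measurable_seq2_coordinate:
  "(\<lambda>x. x c) \<in> measurable (borel_of_topology (seq2_topology \<alpha>)) (count_space UNIV)"
proof (cases "c < \<alpha>")
  case True
  have "continuous_map (seq2_topology \<alpha>) (discrete_topology UNIV) (\<lambda>x. x c)"
    unfolding seq2_topology_def using True by (intro continuous_map_product_projection) simp
  then have "openin (seq2_topology \<alpha>) ((\<lambda>x. x c) -` U \<inter> topspace (seq2_topology \<alpha>))" for U
    by (simp add: continuous_map_def vimage_def Int_def conj_commute)
  then show ?thesis
    by (auto simp: measurable_def space_borel_of_topology
        intro: openin_in_sets_borel_of_topology)
next
  case False
  then have "x c = undefined" if "x \<in> space (borel_of_topology (seq2_topology \<alpha>))" for x
    using that PiE_arb[of x "{..<\<alpha>}" _ c]
    by (simp add: space_borel_of_topology seq2_topology_def)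
  then have "?thesis \<longleftrightarrow> (\<lambda>_. undefined)
      \<in> measurable (borel_of_topology (seq2_topology \<alpha>)) (count_space (UNIV :: bool set))"
    by (rule measurable_cong)
  then show ?thesis
    by simp
qed

text \<open>Here \<open>x (e n k)\<close> stands for \<open>k \<in> P\<^sub>n\<close>. If \<open>P\<^sub>n \<inter> A\<^sub>\<alpha>\<close> is infinite, no bound exists and the
  value is a fixed arbitrary number.\<close>

definition intersection_bound ::
    "(nat \<Rightarrow> nat \<Rightarrow> omega1) \<Rightarrow> (omega1 \<Rightarrow> nat set) \<Rightarrow> omega1 \<Rightarrow> (omega1 \<Rightarrow> bool) \<Rightarrow> nat \<Rightarrow> nat"
  where "intersection_bound e A \<alpha> x n = (LEAST m. \<forall>k. m \<le> k \<longrightarrow> k \<in> A \<alpha> \<longrightarrow> \<not> x (e n k))"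

lemma borel_map_seq2_intersection_bound: "borel_map_seq2 (intersection_bound e A)"
  unfolding borel_map_seq2_def
proof (intro allI measurable_coordinatewise_then_product)
  fix \<alpha> n
  let ?M = "borel_of_topology (seq2_topology \<alpha>)"
  note measurable_seq2_coordinate[measurable]
  have "(\<lambda>x. intersection_bound e A \<alpha> x n) \<in> measurable ?M (count_space UNIV)"
    unfolding intersection_bound_def by measurable
  then show "(\<lambda>x. intersection_bound e A \<alpha> x n) \<in> borel_measurable ?M"
    by (rule measurable_compose) simp
qed

text \<open>The values of \<open>x\<close> agree with the code of \<open>P\<close> only at the places listed by \<open>e\<close>, so the
  statement applies to every restriction of a code to a large enough \<open>\<alpha>\<close>.\<close>

lemma Int_subset_intersection_bound:
  assumes "finite (P n \<inter> A \<alpha>)" and "\<And>k. x (e n k) \<longleftrightarrow> k \<in> P n"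
  shows "P n \<inter> A \<alpha> \<subseteq> {..<intersection_bound e A \<alpha> x n}"
proof -
  obtain m where "P n \<inter> A \<alpha> \<subseteq> {..<m}"
    using assms(1) finite_nat_iff_bounded by blast
  then have "\<exists>m. \<forall>k. m \<le> k \<longrightarrow> k \<in> A \<alpha> \<longrightarrow> \<not> x (e n k)"
    using assms(2) by (metis IntI lessThan_iff linorder_not_less subsetD)
  then have "\<forall>k. intersection_bound e A \<alpha> x n \<le> k \<longrightarrow> k \<in> A \<alpha> \<longrightarrow> \<not> x (e n k)"
    unfolding intersection_bound_def by (rule LeastI_ex)
  then show ?thesis
    using assms(2) by (metis IntE lessThan_iff linorder_not_less subsetI)
qed

theorem theorem3p2:
  fixes A :: "omega1 \<Rightarrow> nat set"
  assumes "diamond_baire_less"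
    and "almost_disjoint_family (range A)"
  shows "\<exists>g :: nat \<Rightarrow> omega1 \<Rightarrow> nat. \<forall>P :: nat \<Rightarrow> nat set.
    stationary_omega1 {\<alpha>. \<exists>n. infinite (P n \<inter> A \<alpha>)} \<or>
    stationary_omega1 {\<alpha>. \<forall>n. P n \<inter> A \<alpha> \<subseteq> {..<g n \<alpha>}}"
proof -
  have "infinite (UNIV :: omega1 set)"
    using uncountable_omega1 countable_finite by blast
  then obtain h :: "nat \<Rightarrow> omega1" where h: "inj h"
    using infinite_countable_subset by blast
  obtain \<delta> where \<delta>: "h i < \<delta>" for i
    using countable_omega1_bounded[of "range h"] by auto
  define e where "e n k = h (prod_encode (n, k))" for n k
  let ?F = "intersection_bound e A"
  obtain g where g: "\<And>f. stationary_omega1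
      {\<alpha>. less_everywhere (?F \<alpha> (restrict f {..<\<alpha>})) (g \<alpha>)}"
    using assms(1) borel_map_seq2_intersection_bound unfolding diamond_baire_less_def by metis
  have "stationary_omega1 {\<alpha>. \<forall>n. P n \<inter> A \<alpha> \<subseteq> {..<g \<alpha> n}}"
    if nonstationary: "\<not> stationary_omega1 {\<alpha>. \<exists>n. infinite (P n \<inter> A \<alpha>)}" for P
    unfolding stationary_omega1_def
  proof (intro allI impI)
    fix D
    assume "club_omega1 D"
    obtain C where "club_omega1 C" and C: "\<And>\<alpha> n. \<alpha> \<in> C \<Longrightarrow> finite (P n \<inter> A \<alpha>)"
      using nonstationary unfolding stationary_omega1_def by blast
    define f where "f c = (case prod_decode (inv h c) of (n, k) \<Rightarrow> k \<in> P n)" for c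
    have f: "f (e n k) \<longleftrightarrow> k \<in> P n" for n k
      using h by (simp add: f_def e_def)
    have "club_omega1 (C \<inter> D \<inter> {\<delta><..})"
      using \<open>club_omega1 C\<close> \<open>club_omega1 D\<close> club_omega1_greaterThan
      by (intro club_omega1_Int)
    then obtain \<alpha> where \<alpha>: "\<alpha> \<in> C" "\<alpha> \<in> D" "\<delta> < \<alpha>"
      and dom: "\<And>n. ?F \<alpha> (restrict f {..<\<alpha>}) n < g \<alpha> n"
      using g[of f] unfolding stationary_omega1_def less_everywhere_def by blast
    have "restrict f {..<\<alpha>} (e n k) \<longleftrightarrow> k \<in> P n" for n k
      using f \<delta> less_trans[OF _ \<alpha>(3)] by (simp add: e_def)
    then have "P n \<inter> A \<alpha> \<subseteq> {..<?F \<alpha> (restrict f {..<\<alpha>}) n}" for n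
      using C[OF \<alpha>(1)] by (intro Int_subset_intersection_bound)
    then have "P n \<inter> A \<alpha> \<subseteq> {..<g \<alpha> n}" for n
      using dom[of n] by (meson lessThan_subset_iff less_imp_le subset_trans)
    then show "{\<alpha>. \<forall>n. P n \<inter> A \<alpha> \<subseteq> {..<g \<alpha> n}} \<inter> D \<noteq> {}"
      using \<alpha>(2) by blast
  qed
  then show ?thesis
    by (intro exI[of _ "\<lambda>n \<alpha>. g \<alpha> n"]) blast
qed

end
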